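(* Let $R$ be a UFD and let $B=\begin{bmatrix} e&f\\ g&h\end{bmatrix}\in M_2(R)$. (i) If $e=h$, $f=0$ and $g=0$ (i.e. $B$ is a scalar matrix), then $\mathrm{Cen}_{M_2(R)}(B)=M_2(R)$. (ii) If at least one of $e-h,f,g$ is nonzero, then $$\mathrm{Cen}_{M_2(R)}(B)=\left\{m^{-1}w\begin{bmatrix} e-h&f\\ g&0\end{bmatrix}+vE\ \middle|\ v,w\in R\right\},$$ where $m^{-1}$ is the inverse of $m:=\gcd(e-h,f,g)$ in the quotient field of $R$.
   Context: $\mathrm{Cen}_{M_2(R)}(B)$ is the centralizer of $B$ in $M_2(R)$, $E$ is the $2\times 2$ identity matrix, and $\gcd(X)$ denotes an arbitrary greatest common divisor of $X$ in $R$. *)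

theory Defs
  imports
    "Berlekamp_Zassenhaus.Unique_Factorization"
    "HOL-Computational_Algebra.Polynomial_Factorial"
    "Jordan_Normal_Form.Matrix"
begin

definition mat_centralizer :: "nat \<Rightarrow> 'a :: semiring_0 mat \<Rightarrow> 'a mat set" where
  "mat_centralizer n B = {A \<in> carrier_mat n n. A * B = B * A}"

(* A greatest common divisor is determined only up to associates, and the class ufd fixes no
   normalized representative; being a greatest common divisor is therefore a predicate. *)
definition is_gcd_of_set :: "'a :: comm_semiring_1 \<Rightarrow> 'a set \<Rightarrow> bool" where
  "is_gcd_of_set m X \<longleftrightarrow> (\<forall>x\<in>X. m dvd x) \<and> (\<forall>d. (\<forall>x\<in>X. d dvd x) \<longrightarrow> d dvd m)"

lemma ex_gcd_of_triple: "\<exists>m. is_gcd_of_set m {a, b, c :: 'a :: ufd}"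
proof -
  obtain k where k: "k dvd b" "k dvd c" "\<And>d. d dvd b \<Longrightarrow> d dvd c \<Longrightarrow> d dvd k"
    using some_gcd.gcd_exists[of b c] by (auto simp: is_gcd_def)
  obtain m where m: "m dvd a" "m dvd k" "\<And>d. d dvd a \<Longrightarrow> d dvd k \<Longrightarrow> d dvd m"
    using some_gcd.gcd_exists[of a k] by (auto simp: is_gcd_def)
  have "is_gcd_of_set m {a, b, c}"
    unfolding is_gcd_of_set_def
    using k(3) m(1,3) dvd_trans[OF m(2) k(1)] dvd_trans[OF m(2) k(2)] by simp
  then show ?thesis ..
qed

end

(* With the difference of the diagonal entries, each 2 x 2 matrix determines a triple, and two such
   matrices commute iff their triples (x, y, z) and (a, b, c) have vanishing 2 x 2 minors. If m is a
   gcd of a, b, c and a is nonzero, then a divides x a, x b = a y and x c = a z, hence it divides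
   their gcd x m. The quotient w satisfies m (x, y, z) = w (a, b, c), which is the required
   parametrization. *)
theory Submission
  imports Defs
begin

text \<open>The triple scaled by \<open>x\<close> has some gcd \<open>k\<close>, and
  \<open>x * m\<close> divides it, say \<open>k = x * (m * u)\<close>. Cancelling \<open>x\<close>
  makes \<open>m * u\<close> a common divisor of \<open>a\<close>, \<open>b\<close>,
  \<open>c\<close>, hence a divisor of \<open>m\<close>. So \<open>k\<close> divides
  \<open>x * m\<close>, and every common divisor \<open>d\<close> divides \<open>k\<close>.\<close>

lemma is_gcd_of_triple_mult:
  fixes a b c d m x :: "'a :: ufd"
  assumes m: "is_gcd_of_set m {a, b, c}"
    and d: "d dvd x * a" "d dvd x * b" "d dvd x * c"
  shows "d dvd x * m"
proof (cases "x = 0")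
  case False
  obtain k where k: "is_gcd_of_set k {x * a, x * b, x * c}"
    using ex_gcd_of_triple by blast
  have "x * m dvd k"
    using k m by (auto simp: is_gcd_of_set_def)
  then obtain u where u: "k = x * (m * u)"
    by (auto simp: dvd_def ac_simps)
  have "m * u dvd a" "m * u dvd b" "m * u dvd c"
    using k False by (simp_all add: is_gcd_of_set_def u)
  then have "m * u dvd m"
    using m by (auto simp: is_gcd_of_set_def)
  then have "k dvd x * m"
    unfolding u by (rule mult_dvd_mono[OF dvd_refl])
  moreover have "d dvd k"
    using k d by (auto simp: is_gcd_of_set_def)
  ultimately show ?thesis
    by (rule dvd_trans[rotated])
qed simp

lemma proportional_triple_aux:
  fixes a b c m x y z :: "'a :: ufd"
  assumes m: "is_gcd_of_set m {a, b, c}" and "a \<noteq> 0"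
    and y: "a * y = x * b" and z: "a * z = x * c"
  shows "\<exists>w. m * x = w * a \<and> m * y = w * b \<and> m * z = w * c"
proof -
  have "a dvd x * m"
    by (rule is_gcd_of_triple_mult[OF m]) (simp_all flip: y z)
  then obtain w where w: "m * x = w * a"
    by (auto simp: dvd_def ac_simps)
  \<comment> \<open>The quotient \<open>w\<close> found from \<open>x\<close> also serves
    \<open>y\<close> and \<open>z\<close>: \<open>a * m * y = m * x * b = w * a * b\<close>, after
    which the nonzero \<open>a\<close> cancels.\<close>
  have "a * (m * y) = a * (w * b)"
    using y w by (metis mult.assoc mult.commute)
  moreover have "a * (m * z) = a * (w * c)"
    using z w by (metis mult.assoc mult.commute)
  ultimately show ?thesis
    using w \<open>a \<noteq> 0\<close> by auto
qed

text \<open>Both the gcd and the vanishing of all three minors survive a permutation of the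
  coordinates, so any nonzero entry may be moved to the front.\<close>

lemma proportional_triple:
  fixes a b c m x y z :: "'a :: ufd"
  assumes m: "is_gcd_of_set m {a, b, c}" and nz: "a \<noteq> 0 \<or> b \<noteq> 0 \<or> c \<noteq> 0"
    and minors: "a * y = x * b" "a * z = x * c" "b * z = y * c"
  shows "\<exists>w. m * x = w * a \<and> m * y = w * b \<and> m * z = w * c"
proof -
  have perm: "is_gcd_of_set m {b, a, c}" "is_gcd_of_set m {c, a, b}"
    using m by (simp_all add: insert_commute)
  consider "a \<noteq> 0" | "b \<noteq> 0" | "c \<noteq> 0"
    using nz by blast
  then show ?thesis
  proof cases
    case 1
    then show ?thesis
      using proportional_triple_aux[OF m] minors by blast
  next
    case 2
    then show ?thesis
      using proportional_triple_aux[OF perm(1), of x y z] minors by (auto simp: mult.commute)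
  next
    case 3
    then show ?thesis
      using proportional_triple_aux[OF perm(2), of x z y] minors by (auto simp: mult.commute)
  qed
qed

lemma mat_eq_iff_2:
  assumes "A \<in> carrier_mat 2 2" "C \<in> carrier_mat 2 2"
  shows "A = C \<longleftrightarrow> A $$ (0, 0) = C $$ (0, 0) \<and> A $$ (0, 1) = C $$ (0, 1) \<and>
                  A $$ (1, 0) = C $$ (1, 0) \<and> A $$ (1, 1) = C $$ (1, 1)"
  using assms by (auto simp: less_2_cases_iff intro!: eq_matI)

lemma index_mult_mat_2:
  assumes "A \<in> carrier_mat 2 2" "C \<in> carrier_mat 2 2" "i < 2" "j < 2"
  shows "(A * C) $$ (i, j) = A $$ (i, 0) * C $$ (0, j) + A $$ (i, 1) * C $$ (1, j)"
  using assms by (simp add: scalar_prod_def eval_nat_numeral)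

lemma mat_of_rows_list_2:
  "mat_of_rows_list 2 [[a, b], [c, d]] \<in> carrier_mat 2 2"
  "mat_of_rows_list 2 [[a, b], [c, d]] $$ (0, 0) = a"
  "mat_of_rows_list 2 [[a, b], [c, d]] $$ (0, 1) = b"
  "mat_of_rows_list 2 [[a, b], [c, d]] $$ (1, 0) = c"
  "mat_of_rows_list 2 [[a, b], [c, d]] $$ (1, 1) = d"
  by (auto simp: mat_of_rows_list_def)

text \<open>The two off-diagonal entries of the commutation equation give the first two minors; both
  diagonal entries reduce to the third.\<close>

lemma mat_centralizer_2_iff:
  fixes A :: "'a :: comm_ring_1 mat"
  assumes A: "A \<in> carrier_mat 2 2"
  shows "A \<in> mat_centralizer 2 (mat_of_rows_list 2 [[e, f], [g, h]]) \<longleftrightarrow>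
           (e - h) * A $$ (0, 1) = (A $$ (0, 0) - A $$ (1, 1)) * f \<and>
           (e - h) * A $$ (1, 0) = (A $$ (0, 0) - A $$ (1, 1)) * g \<and>
           f * A $$ (1, 0) = A $$ (0, 1) * g"
proof -
  let ?B = "mat_of_rows_list 2 [[e, f], [g, h]]"
  note B = mat_of_rows_list_2(1)[of e f g h]
  have "A * ?B = ?B * A \<longleftrightarrow>
      A $$ (0, 0) * e + A $$ (0, 1) * g = e * A $$ (0, 0) + f * A $$ (1, 0) \<and>
      A $$ (0, 0) * f + A $$ (0, 1) * h = e * A $$ (0, 1) + f * A $$ (1, 1) \<and>
      A $$ (1, 0) * e + A $$ (1, 1) * g = g * A $$ (0, 0) + h * A $$ (1, 0) \<and>
      A $$ (1, 0) * f + A $$ (1, 1) * h = g * A $$ (0, 1) + h * A $$ (1, 1)"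
    using mat_eq_iff_2[OF mult_carrier_mat[OF A B] mult_carrier_mat[OF B A]]
    by (simp only: index_mult_mat_2[OF A B] index_mult_mat_2[OF B A] mat_of_rows_list_2
        pos2 one_less_numeral_iff semiring_norm(76))
  also have "\<dots> \<longleftrightarrow> (e - h) * A $$ (0, 1) = (A $$ (0, 0) - A $$ (1, 1)) * f \<and>
           (e - h) * A $$ (1, 0) = (A $$ (0, 0) - A $$ (1, 1)) * g \<and>
           f * A $$ (1, 0) = A $$ (0, 1) * g"
    by (auto simp: algebra_simps)
  finally show ?thesis
    using A by (simp add: mat_centralizer_def)
qed

text \<open>Keeping \<open>m\<close> on the left states the parametrization inside the ring, without
  fractions. Conversely, two triples related in this way are proportional, so their minors
  vanish.\<close>

lemma mat_centralizer_2_gcd_iff: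
  fixes A :: "'a :: ufd mat"
  assumes A: "A \<in> carrier_mat 2 2" and m: "is_gcd_of_set m {e - h, f, g}"
    and nz: "e - h \<noteq> 0 \<or> f \<noteq> 0 \<or> g \<noteq> 0"
  shows "A \<in> mat_centralizer 2 (mat_of_rows_list 2 [[e, f], [g, h]]) \<longleftrightarrow>
           (\<exists>w. m * (A $$ (0, 0) - A $$ (1, 1)) = w * (e - h) \<and>
                m * A $$ (0, 1) = w * f \<and> m * A $$ (1, 0) = w * g)"
    (is "?L \<longleftrightarrow> (\<exists>w. ?R w)")
proof
  assume ?L
  then show "\<exists>w. ?R w"
    using proportional_triple[OF m nz] by (simp add: mat_centralizer_2_iff[OF A])
next
  assume "\<exists>w. ?R w"
  then obtain w where w: "?R w" ..
  have "m \<noteq> 0"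
    using m nz by (auto simp: is_gcd_of_set_def)
  \<comment> \<open>Both sides become \<open>w * p * q\<close> after multiplication by
    \<open>m\<close>.\<close>
  have minor: "p * y = x * q" if "m * x = w * p" "m * y = w * q" for p q x y
  proof -
    have "m * (p * y) = m * (x * q)"
      using that by (metis mult.assoc mult.commute)
    then show ?thesis
      using \<open>m \<noteq> 0\<close> by simp
  qed
  show ?L
    unfolding mat_centralizer_2_iff[OF A] using w by (blast intro: minor)
qed

text \<open>The inverse of \<open>m\<close> lives in the quotient field, so the centralizer is
  embedded there by \<open>map_mat to_fract\<close> before the sets are compared. The claim covers
  every choice of gcd, and \<open>ex_gcd_of_triple\<close> provides one.\<close>

theorem corollary2p3:
  fixes e f g h :: "'a :: ufd"
    and B :: "'a mat"
  assumes B: "B = mat_of_rows_list 2 [[e, f], [g, h]]"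
  shows "(e = h \<and> f = 0 \<and> g = 0 \<longrightarrow> mat_centralizer 2 B = carrier_mat 2 2) \<and>
         (\<forall>m. (e - h \<noteq> 0 \<or> f \<noteq> 0 \<or> g \<noteq> 0) \<and> is_gcd_of_set m {e - h, f, g} \<longrightarrow>
            map_mat to_fract ` mat_centralizer 2 B =
              {(inverse (to_fract m) * to_fract w) \<cdot>\<^sub>m
                  map_mat to_fract (mat_of_rows_list 2 [[e - h, f], [g, 0]])
                + to_fract v \<cdot>\<^sub>m 1\<^sub>m 2 | v w. True})"
proof (intro conjI impI allI)
  assume scalar: "e = h \<and> f = 0 \<and> g = 0"
  have "mat_centralizer 2 B \<subseteq> carrier_mat 2 2"
    by (auto simp: mat_centralizer_def)
  moreover have "A \<in> mat_centralizer 2 B" if "A \<in> carrier_mat 2 2" for A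
    using scalar by (simp add: B mat_centralizer_2_iff[OF that])
  ultimately show "mat_centralizer 2 B = carrier_mat 2 2"
    by blast
next
  fix m
  assume "(e - h \<noteq> 0 \<or> f \<noteq> 0 \<or> g \<noteq> 0) \<and> is_gcd_of_set m {e - h, f, g}"
  then have nz: "e - h \<noteq> 0 \<or> f \<noteq> 0 \<or> g \<noteq> 0" and m: "is_gcd_of_set m {e - h, f, g}"
    by blast+
  then have m0: "m \<noteq> 0"
    by (auto simp: is_gcd_of_set_def)
  note cen = mat_centralizer_2_gcd_iff[OF _ m nz, folded B]
  define F where "F v w = (inverse (to_fract m) * to_fract w) \<cdot>\<^sub>m
      map_mat to_fract (mat_of_rows_list 2 [[e - h, f], [g, 0]]) + to_fract v \<cdot>\<^sub>m 1\<^sub>m 2" for v w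
  have F_carrier: "F v w \<in> carrier_mat 2 2" for v w
    by (auto simp: F_def mat_of_rows_list_2)
  \<comment> \<open>Clearing the denominator \<open>m\<close> brings each entrywise equation back to
    the ring.\<close>
  have cancel: "to_fract x = inverse (to_fract m) * to_fract w * to_fract p \<longleftrightarrow> m * x = w * p"
    for x w p
  proof -
    have "to_fract x = inverse (to_fract m) * to_fract w * to_fract p \<longleftrightarrow>
        to_fract m * to_fract x = to_fract w * to_fract p"
      using m0 by (simp add: field_simps)
    then show ?thesis
      by (simp flip: to_fract_mult)
  qed
  \<comment> \<open>The lower right entry of \<open>F v w\<close> is just \<open>v\<close>;
    subtracting it from the upper left entry leaves a condition on the difference of the diagonal
    entries of \<open>A\<close>.\<close>
  have F_iff: "map_mat to_fract A = F v w \<longleftrightarrow>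
      m * (A $$ (0, 0) - A $$ (1, 1)) = w * (e - h) \<and> m * A $$ (0, 1) = w * f \<and>
      m * A $$ (1, 0) = w * g \<and> A $$ (1, 1) = v" if A: "A \<in> carrier_mat 2 2" for A v w
  proof -
    have B': "mat_of_rows_list 2 [[e - h, f], [g, 0]] \<in> carrier_mat 2 2"
      by (rule mat_of_rows_list_2)
    have "map_mat to_fract A = F v w \<longleftrightarrow>
        to_fract (A $$ (0, 0)) = inverse (to_fract m) * to_fract w * to_fract (e - h) + to_fract v \<and>
        to_fract (A $$ (0, 1)) = inverse (to_fract m) * to_fract w * to_fract f \<and>
        to_fract (A $$ (1, 0)) = inverse (to_fract m) * to_fract w * to_fract g \<and>
        to_fract (A $$ (1, 1)) = to_fract v"
      using A B' mat_of_rows_list_2[of "e - h" f g 0]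
      by (subst mat_eq_iff_2[OF _ F_carrier]) (auto simp: F_def)
    also have "\<dots> \<longleftrightarrow>
        to_fract (A $$ (0, 0) - A $$ (1, 1)) =
          inverse (to_fract m) * to_fract w * to_fract (e - h) \<and>
        to_fract (A $$ (0, 1)) = inverse (to_fract m) * to_fract w * to_fract f \<and>
        to_fract (A $$ (1, 0)) = inverse (to_fract m) * to_fract w * to_fract g \<and>
        A $$ (1, 1) = v"
      by (auto simp: to_fract_diff diff_eq_eq)
    finally show ?thesis
      by (simp only: cancel)
  qed
  have "map_mat to_fract ` mat_centralizer 2 B = {F v w | v w. True}"
  proof (intro equalityI subsetI)
    fix X
    assume "X \<in> map_mat to_fract ` mat_centralizer 2 B"
    then obtain A where A: "A \<in> mat_centralizer 2 B" and X: "X = map_mat to_fract A"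
      by blast
    then have "A \<in> carrier_mat 2 2"
      by (simp add: mat_centralizer_def)
    with A X show "X \<in> {F v w | v w. True}"
      using cen F_iff by blast
  next
    fix X
    assume "X \<in> {F v w | v w. True}"
    then obtain v w where X: "X = F v w"
      by blast
    \<comment> \<open>Dividing the triple by \<open>m\<close> inside the ring shows that
      \<open>F v w\<close> has entries from the ring, which gives the preimage
      \<open>?A\<close>.\<close>
    obtain p' f' g' where pfg: "e - h = m * p'" "f = m * f'" "g = m * g'"
      using m by (auto simp: is_gcd_of_set_def elim!: dvdE)
    let ?A = "mat_of_rows_list 2 [[w * p' + v, w * f'], [w * g', v]]"
    have A: "?A \<in> carrier_mat 2 2"
      by (rule mat_of_rows_list_2)
    have eqs: "m * (?A $$ (0, 0) - ?A $$ (1, 1)) = w * (e - h) \<and> m * ?A $$ (0, 1) = w * f \<and>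
        m * ?A $$ (1, 0) = w * g"
      unfolding mat_of_rows_list_2 pfg by (simp add: ac_simps)
    then have "?A \<in> mat_centralizer 2 B"
      using cen[OF A] by blast
    moreover have "X = map_mat to_fract ?A"
      using F_iff[OF A] eqs mat_of_rows_list_2(5) X by metis
    ultimately show "X \<in> map_mat to_fract ` mat_centralizer 2 B"
      by blast
  qed
  then show "map_mat to_fract ` mat_centralizer 2 B =
      {(inverse (to_fract m) * to_fract w) \<cdot>\<^sub>m
          map_mat to_fract (mat_of_rows_list 2 [[e - h, f], [g, 0]])
        + to_fract v \<cdot>\<^sub>m 1\<^sub>m 2 | v w. True}"
    by (simp only: F_def)
qed

end
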